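(* Let $K$ and $M$ be integers with $1\le M\le K-1$. For the PIR-PCSI--I setting with $K$ messages and side information support size $M$, the capacity and the scalar-linear capacity are both equal to $(K-M)^{-1}$.
   Context: Setup. Let $\mathcal{K}=\{1,\dots,K\}$, let $q$ be a prime power, $l\ge 1$ an integer, $\mathbb{F}_q^{\times}=\mathbb{F}_q\setminus\{0\}$ and $L=l\log_2 q$. Let $\mathcal{S}$ be the set of all $M$-subsets of $\mathcal{K}$ and $\mathcal{C}$ the set of all length-$M$ sequences over $\mathbb{F}_q^{\times}$. Boldface denotes random variables, regular letters their realizations; entropies are Shannon entropies in bits. A server stores messages $\mathbf{X}_1,\dots,\mathbf{X}_K$, i.i.d. uniform on $\mathbb{F}_{q^l}$ (so $H(\mathbf{X}_i)=L$); write $\mathbf{X}_{\mathcal{K}}=\{\mathbf{X}_1,\dots,\mathbf{X}_K\}$. A user wants $X_W$ ($W\in\mathcal{K}$ is the demand index) and knows the coded side information $Y^{[S,C]}=\sum_{i\in S}c_iX_i$, where $S=\{i_1,\dots,i_M\}\in\mathcal{S}$ (the support index set) and $C=(c_{i_1},\dots,c_{i_M})\in\mathcal{C}$. $\mathbf{S}$ is uniform on $\mathcal{S}$, $\mathbf{C}$ is uniform on $\mathcal{C}$ and independent of $(\mathbf{W},\mathbf{S})$, and the messages are independent of $(\mathbf{W},\mathbf{S},\mathbf{C})$. Model I: given $\mathbf{S}=S$, $\mathbf{W}$ is uniform on $\mathcal{K}\setminus S$ (so the indicator $\theta=\mathds{1}_{\{\mathbf{W}\in\mathbf{S}\}}$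 equals $0$). Protocol. The user sends a query $\mathbf{Q}=\mathbf{Q}^{[\mathbf{W},\mathbf{S},\mathbf{C}]}$, a possibly stochastic function of $(\mathbf{W},\mathbf{S},\mathbf{C})$ only (any extra randomness is independent of the messages). The server replies with an answer $\mathbf{A}=\mathbf{A}^{[\mathbf{W},\mathbf{S},\mathbf{C}]}$, a deterministic function of $\mathbf{Q}$, the indicator $\mathds{1}_{\{\mathbf{W}\in\mathbf{S}\}}$ and $\mathbf{X}_{\mathcal{K}}$. Recoverability: $H(\mathbf{X}_{\mathbf{W}}\mid \mathbf{A},\mathbf{Q},\mathds{1}_{\{\mathbf{W}\in\mathbf{S}\}},\mathbf{Y}^{[\mathbf{S},\mathbf{C}]},\mathbf{W},\mathbf{S},\mathbf{C})=0$. $(W,S)$-privacy: $I(\mathbf{W},\mathbf{S};\mathbf{Q}\mid \mathds{1}_{\{\mathbf{W}\in\mathbf{S}\}})=0$. A PIR-PCSI--I protocol is a protocol under Model I satisfying recoverability and $(W,S)$-privacy. Its rate is $L/H(\mathbf{A}\mid \mathds{1}_{\{\mathbf{W}\in\mathbf{S}\}}=0)$. It is scalar-linear if the answer consists only of linear combinations of $X_1,\dots,X_K$ with coefficients in $\mathbb{F}_q$ (the coefficients being determined by the query). The capacity (resp. scalar-linear capacity) of the setting is the supremum of the rates over all (resp. all scalar-linear) PIR-PCSI--I protocols and over all prime powers $q$ and all $l\ge1$. *)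

theory Defs
  imports "HOL-Probability.Probability" "HOL-Algebra.Subrings" "HOL-Number_Theory.Prime_Powers"
    "HOL-Library.Monad_Syntax"
begin

section \<open>Shannon quantities of discrete random variables, in bits\<close>

text \<open>
  The library notions of entropy are taken on the probability space whose points are the outcomes
  of positive probability. This space is countable, so every function on it is a discrete random
  variable with values in a countable measurable space.
  If \<open>X\<close> has infinite entropy, the library value \<open>entropy_of p X\<close> is \<open>0\<close>. The other two quantities
  below are used only when \<open>X\<close> has finite range, where they are finite.
\<close>

definition pmf_space :: "'a pmf \<Rightarrow> 'a measure" where
  "pmf_space p = restrict_space (measure_pmf p) (set_pmf p)"

definition entropy_of :: "'a pmf \<Rightarrow> ('a \<Rightarrow> 'b) \<Rightarrow> real" where
  "entropy_of p X = prob_space.entropy (pmf_space p) 2 (count_space (X ` set_pmf p)) X"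

definition cond_entropy_of :: "'a pmf \<Rightarrow> ('a \<Rightarrow> 'b) \<Rightarrow> ('a \<Rightarrow> 'c) \<Rightarrow> real" where
  "cond_entropy_of p X Y = prob_space.conditional_entropy (pmf_space p) 2
     (count_space (X ` set_pmf p)) (count_space (Y ` set_pmf p)) X Y"

definition cond_mutual_info_of ::
    "'a pmf \<Rightarrow> ('a \<Rightarrow> 'b) \<Rightarrow> ('a \<Rightarrow> 'c) \<Rightarrow> ('a \<Rightarrow> 'd) \<Rightarrow> real" where
  "cond_mutual_info_of p X Y Z = prob_space.conditional_mutual_information (pmf_space p) 2
     (count_space (X ` set_pmf p)) (count_space (Y ` set_pmf p)) (count_space (Z ` set_pmf p)) X Y Z"


section \<open>Private information retrieval with coded side information, Model I\<close>

text \<open>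
  An outcome \<open>(W, S, C, X, Q)\<close> consists of the demand index, the support index set, the coefficient
  sequence, the messages and the query. Queries range over an arbitrary discrete alphabet, encoded
  in the natural numbers. Field elements are integers: every finite field has an isomorphic copy
  whose carrier is a set of integers.
\<close>

type_synonym outcome = "nat \<times> nat set \<times> int list \<times> (nat \<Rightarrow> int) \<times> nat"

text \<open>
  \<open>F\<close> is the field with \<open>q ^ l\<close> elements and \<open>Fq\<close> its subfield with \<open>q\<close> elements.
  The stochastic map \<open>query\<close> sees only \<open>(W, S, C)\<close>; the map \<open>answer\<close> sees only the query, the
  indicator of \<open>W \<in> S\<close> and the messages. An answer is a finite sequence of symbols.
\<close>

locale pcsi_I = field F for F :: "int ring" (structure) +
  fixes Fq :: "int set" and q l :: nat
    and K M :: nat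
    and query :: "nat \<Rightarrow> nat set \<Rightarrow> int list \<Rightarrow> nat pmf"
    and answer :: "nat \<Rightarrow> nat \<Rightarrow> (nat \<Rightarrow> int) \<Rightarrow> int list"
  assumes primepow_q: "primepow q"
    and l_pos: "1 \<le> l"
    and card_F: "card (carrier F) = q ^ l"
    and subfield_Fq: "subfield Fq F"
    and card_Fq: "card Fq = q"
begin

definition supports :: "nat set set" where
  "supports = {S. S \<subseteq> {1..K} \<and> card S = M}"

definition coeff_seqs :: "int list set" where
  "coeff_seqs = {C. set C \<subseteq> Fq - {\<zero>} \<and> length C = M}"

definition messages :: "(nat \<Rightarrow> int) set" where
  "messages = {1..K} \<rightarrow>\<^sub>E carrier F"

definition joint :: "outcome pmf" where
  "joint = do {
     S \<leftarrow> pmf_of_set supports;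
     W \<leftarrow> pmf_of_set ({1..K} - S);
     C \<leftarrow> pmf_of_set coeff_seqs;
     X \<leftarrow> pmf_of_set messages;
     Q \<leftarrow> query W S C;
     return_pmf (W, S, C, X, Q)
   }"

definition rv_W :: "outcome \<Rightarrow> nat" where
  "rv_W = (\<lambda>(W, S, C, X, Q). W)"

definition rv_S :: "outcome \<Rightarrow> nat set" where
  "rv_S = (\<lambda>(W, S, C, X, Q). S)"

definition rv_C :: "outcome \<Rightarrow> int list" where
  "rv_C = (\<lambda>(W, S, C, X, Q). C)"

definition rv_X :: "outcome \<Rightarrow> nat \<Rightarrow> int" where
  "rv_X = (\<lambda>(W, S, C, X, Q). X)"

definition rv_Q :: "outcome \<Rightarrow> nat" where
  "rv_Q = (\<lambda>(W, S, C, X, Q). Q)"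

definition rv_theta :: "outcome \<Rightarrow> nat" where
  "rv_theta \<omega> = of_bool (rv_W \<omega> \<in> rv_S \<omega>)"

text \<open>
  The \<open>j\<close>-th coefficient belongs to the \<open>j\<close>-th smallest index of the support.
\<close>

definition rv_Y :: "outcome \<Rightarrow> int" where
  "rv_Y \<omega> = (\<Oplus>j\<in>{..<M}. rv_C \<omega> ! j \<otimes> rv_X \<omega> (sorted_list_of_set (rv_S \<omega>) ! j))"

definition rv_A :: "outcome \<Rightarrow> int list" where
  "rv_A \<omega> = answer (rv_Q \<omega>) (rv_theta \<omega>) (rv_X \<omega>)"

definition recoverable :: bool where
  "recoverable \<longleftrightarrow>
     cond_entropy_of joint (\<lambda>\<omega>. rv_X \<omega> (rv_W \<omega>))
       (\<lambda>\<omega>. (rv_A \<omega>, rv_Q \<omega>, rv_theta \<omega>, rv_Y \<omega>, rv_W \<omega>, rv_S \<omega>, rv_C \<omega>)) = 0"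

definition WS_private :: bool where
  "WS_private \<longleftrightarrow> cond_mutual_info_of joint (\<lambda>\<omega>. (rv_W \<omega>, rv_S \<omega>)) rv_Q rv_theta = 0"

definition scalar_linear :: bool where
  "scalar_linear \<longleftrightarrow> (\<exists>coeffs :: nat \<Rightarrow> (nat \<Rightarrow> int) list.
     (\<forall>Q. \<forall>v\<in>set (coeffs Q). v \<in> {1..K} \<rightarrow> Fq) \<and>
     (\<forall>\<omega>\<in>set_pmf joint.
        rv_A \<omega> = map (\<lambda>v. \<Oplus>i\<in>{1..K}. v i \<otimes> rv_X \<omega> i) (coeffs (rv_Q \<omega>))))"

text \<open>
  The entropy of the answer is taken in the distribution conditioned on the event that the
  indicator is \<open>0\<close>. An answer of infinite entropy gives the rate \<open>L / 0 = 0\<close>, as it should.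
\<close>

definition rate :: real where
  "rate = (real l * log 2 (real q)) / entropy_of (cond_pmf joint {\<omega>. rv_theta \<omega> = 0}) rv_A"

end

locale pir_pcsi_I = pcsi_I +
  assumes recoverability: recoverable
    and privacy: WS_private

locale scalar_linear_pir_pcsi_I = pir_pcsi_I +
  assumes scalar_linearity: scalar_linear

definition capacity :: "nat \<Rightarrow> nat \<Rightarrow> ereal" where
  "capacity K M = Sup {ereal (pcsi_I.rate F Fq q l K M query answer) | F Fq q l query answer.
     pir_pcsi_I F Fq q l K M query answer}"

definition scalar_linear_capacity :: "nat \<Rightarrow> nat \<Rightarrow> ereal" where
  "scalar_linear_capacity K M =
     Sup {ereal (pcsi_I.rate F Fq q l K M query answer) | F Fq q l query answer.
       scalar_linear_pir_pcsi_I F Fq q l K M query answer}"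

end

theory Submission
  imports Defs "HOL-Number_Theory.Residues" "HOL-Computational_Algebra.Polynomial"
begin

text \<open>
  Converse: fix a query \<open>Q\<close> of positive probability and a support \<open>S\<close>. By privacy every demand outside
  \<open>S\<close> is compatible with \<open>Q\<close> and \<open>S\<close>, so by recoverability the answer and the \<open>M\<close> messages in \<open>S\<close>
  determine all the others. Hence an answer has at most \<open>(q ^ l) ^ M\<close> preimages among the
  \<open>(q ^ l) ^ K\<close> message vectors. This bounds all point probabilities of the answer, hence its
  min-entropy, hence its Shannon entropy, which is at least \<open>(K - M) * L\<close>.

  Achievability: over a prime field with more than \<open>K\<close> elements, the user asks for the \<open>K - M\<close> parity
  checks of a generalised Reed-Solomon code with evaluation points \<open>1, \<dots>, K\<close>. For every \<open>(W, S)\<close> there is,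
  up to scaling, exactly one combination of them with support \<open>insert W S\<close>, and the column
  multipliers on \<open>S\<close> can be chosen so that its restriction to \<open>S\<close> is the given side information.
  With the remaining multipliers uniform, the multiplier vector is uniform whatever \<open>(W, S)\<close> is.
\<close>

section \<open>Discrete Shannon quantities\<close>

lemma space_pmf_space [simp]: "space (pmf_space p) = set_pmf p"
  by (simp add: pmf_space_def space_restrict_space)

lemma sets_pmf_space [simp]: "sets (pmf_space p) = Pow (set_pmf p)"
  by (auto simp: pmf_space_def sets_restrict_space)

lemma emeasure_pmf_space:
  "B \<subseteq> set_pmf p \<Longrightarrow> emeasure (pmf_space p) B = emeasure (measure_pmf p) B"
  by (simp add: pmf_space_def emeasure_restrict_space)

lemma information_space_pmf_space: "information_space (pmf_space p) 2"
proof -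
  have "prob_space (pmf_space p)"
    by (intro prob_spaceI) (simp add: emeasure_pmf_space emeasure_pmf)
  then show ?thesis
    by (simp add: information_space_def information_space_axioms_def)
qed

lemma measure_map_pmf_image: "measure (map_pmf X p) (X ` set_pmf p) = 1"
  using emeasure_pmf[of "map_pmf X p"]
  by (simp add: measure_pmf.emeasure_eq_measure del: measure_map_pmf)

lemma measurable_pmf_space [simp]:
  "X \<in> measurable (pmf_space p) (count_space A) \<longleftrightarrow> X ` set_pmf p \<subseteq> A"
  by (auto simp: measurable_def)

text \<open>Entropy formulas for densities become available with counting measure as reference. The
  set \<open>A\<close> may exceed the range of \<open>X\<close>: for a pair it will be the product
  of the two ranges.\<close>

lemma distributed_pmf_space:
  assumes A: "X ` set_pmf p \<subseteq> A" "countable A"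
  shows "distributed (pmf_space p) (count_space A) X (\<lambda>x. ennreal (pmf (map_pmf X p) x))"
  unfolding distributed_def
proof (intro conjI)
  show "distr (pmf_space p) (count_space A) X
    = density (count_space A) (\<lambda>x. ennreal (pmf (map_pmf X p) x))" (is "?D = ?E")
  proof (rule measure_eqI_countable[OF _ _ A(2)])
    fix a assume a: "a \<in> A"
    have "emeasure ?D {a} = emeasure (pmf_space p) (X -` {a} \<inter> set_pmf p)"
      using A a by (subst emeasure_distr) auto
    also have "\<dots> = emeasure (measure_pmf p) (X -` {a})"
      by (simp add: emeasure_pmf_space emeasure_Int_set_pmf)
    also have "\<dots> = ennreal (pmf (map_pmf X p) a)"
      by (simp add: pmf_map measure_pmf.emeasure_eq_measure)
    also have "\<dots> = emeasure ?E {a}"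
      using a by (simp add: emeasure_density nn_integral_count_space_indicator[symmetric]
          nn_integral_indicator_finite indicator_eq_0_iff)
    finally show "emeasure ?D {a} = emeasure ?E {a}" .
  qed auto
qed (use A in auto)

text \<open>Entropy averages minus the logarithm of the point probabilities, so it dominates
  min-entropy. The first alternative is an infinite entropy, whose integral takes the default value
  0; over a finite range every function is integrable.\<close>

lemma entropy_of_eq_0_or_ge:
  assumes c: "\<And>x. pmf (map_pmf X p) x \<le> c"
  shows "infinite (X ` set_pmf p) \<and> entropy_of p X = 0 \<or> - log 2 c \<le> entropy_of p X"
proof -
  let ?A = "X ` set_pmf p" and ?f = "pmf (map_pmf X p)"
  interpret information_space "pmf_space p" 2
    by (rule information_space_pmf_space)
  note d = distributed_pmf_space[OF subset_refl, of X p]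
  have eq: "entropy_of p X = - (\<integral>x. ?f x * log 2 (?f x) \<partial>count_space ?A)"
    unfolding entropy_of_def by (rule entropy_distr) (auto intro!: d)
  have pos: "0 < ?f x" if "x \<in> ?A" for x
    using that by (simp add: pmf_positive_iff)
  have int: "integrable (count_space ?A) ?f" and one: "(\<integral>x. ?f x \<partial>count_space ?A) = 1"
    by (simp_all add: integrable_pmf integral_pmf measure_map_pmf_image del: measure_map_pmf)
  show ?thesis
  proof (cases "integrable (count_space ?A) (\<lambda>x. ?f x * log 2 (?f x))")
    case True
    have "(\<integral>x. ?f x * log 2 (?f x) \<partial>count_space ?A) \<le> (\<integral>x. ?f x * log 2 c \<partial>count_space ?A)"
      using True int pos c by (intro integral_mono) (auto intro!: mult_left_mono log_mono)
    also have "\<dots> = log 2 c"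
      using one by simp
    finally show ?thesis
      by (simp add: eq)
  qed (auto simp: eq not_integrable_integral_eq intro: integrable_count_space)
qed

lemma entropy_of_le_log_card:
  assumes "X ` set_pmf p \<subseteq> B" "finite B"
  shows "entropy_of p X \<le> log 2 (card B)"
proof -
  let ?A = "X ` set_pmf p"
  interpret information_space "pmf_space p" 2
    by (rule information_space_pmf_space)
  have fin: "finite ?A"
    using assms finite_subset by blast
  have "entropy_of p X \<le> log 2 (measure (count_space ?A) (space (count_space ?A)))"
    unfolding entropy_of_def
    by (rule entropy_le_space[OF distributed_pmf_space])
      (use fin in \<open>auto intro: finite_measure_count_space integrable_count_space countable_finite\<close>)
  also have "\<dots> = log 2 (card ?A)"
    using fin by (simp add: measure_def emeasure_count_space)
  also have "\<dots> \<le> log 2 (card B)"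
    using fin assms set_pmf_not_empty[of p]
    by (intro log_mono) (auto simp: card_gt_0_iff intro: card_mono)
  finally show ?thesis .
qed

text \<open>Conditional entropy is the sum of the nonnegative terms \<open>h\<close>, and such a
  term is 0 only if the pair has probability 0 or takes up all the probability of its
  \<open>Y\<close>-value. Finiteness of the range of \<open>X\<close> makes the sum converge even
  when \<open>Y\<close> has infinitely many values.\<close>

lemma cond_entropy_of_eq_0_iff:
  assumes fin: "finite (X ` set_pmf p)"
  shows "cond_entropy_of p X Y = 0 \<longleftrightarrow>
    (\<forall>\<omega>\<in>set_pmf p. \<forall>\<omega>'\<in>set_pmf p. Y \<omega> = Y \<omega>' \<longrightarrow> X \<omega> = X \<omega>')"
proof -
  let ?A = "X ` set_pmf p" and ?B = "Y ` set_pmf p"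
  let ?f = "pmf (map_pmf (\<lambda>\<omega>. (X \<omega>, Y \<omega>)) p)" and ?g = "pmf (map_pmf Y p)"
  define h where "h = (\<lambda>z. - (?f z * log 2 (?f z / ?g (snd z))))"
  interpret information_space "pmf_space p" 2
    by (rule information_space_pmf_space)
  have cs: "count_space ?A \<Otimes>\<^sub>M count_space ?B = count_space (?A \<times> ?B)"
    by (simp add: pair_measure_countable)
  have eq: "cond_entropy_of p X Y = (\<integral>z. h z \<partial>count_space (?A \<times> ?B))"
    unfolding cond_entropy_of_def
    by (subst conditional_entropy_generic_eq[OF _ _ distributed_pmf_space _ distributed_pmf_space[of _ _ "?A \<times> ?B", folded cs]])
      (auto simp: h_def cs sigma_finite_measure_count_space_countable split_beta')
  have fg: "?f z \<le> ?g (snd z)" for z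
    by (auto simp: pmf_map intro!: measure_pmf.finite_measure_mono)
  have gpos: "0 < ?g (snd z)" if "z \<in> ?A \<times> ?B" for z
    using that by (auto simp: pmf_positive_iff)
  have h_nonneg: "0 \<le> h z" if "z \<in> ?A \<times> ?B" for z
  proof (cases "?f z = 0")
    case False
    then show ?thesis
      using fg[of z] gpos[OF that] pmf_nonneg[of _ z]
      by (auto simp: h_def less_le mult_le_0_iff)
  qed (simp add: h_def)
  \<comment> \<open>The inequality ln t \<le> t - 1 at t = g / f gives the majorant g / ln 2. Its
    sum over the product is the size of the range of \<open>X\<close> divided by ln 2.\<close>
  have h_le: "h z \<le> ?g (snd z) / ln 2" if "z \<in> ?A \<times> ?B" for z
  proof (cases "?f z = 0")
    case True
    then show ?thesis by (simp add: h_def)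
  next
    case False
    then have f: "0 < ?f z"
      by (simp add: less_le)
    note g = gpos[OF that]
    have "- ln (?f z / ?g (snd z)) = ln (?g (snd z) / ?f z)"
      using f g by (simp add: ln_div)
    also have "\<dots> \<le> ?g (snd z) / ?f z"
      using f g ln_le_minus_one[of "?g (snd z) / ?f z"] by simp
    finally have "?f z * - ln (?f z / ?g (snd z)) \<le> ?f z * (?g (snd z) / ?f z)"
      using f by (intro mult_left_mono) auto
    then show ?thesis
      using f by (simp add: h_def log_def divide_right_mono field_simps)
  qed
  have "integrable (count_space ?A \<Otimes>\<^sub>M count_space ?B) (\<lambda>z. ?g (snd z) / ln 2)"
  proof (rule integrableI_bounded)
    have "(\<integral>\<^sup>+ z. ennreal (norm (?g (snd z) / ln 2)) \<partial>(count_space ?A \<Otimes>\<^sub>M count_space ?B))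
      = (\<integral>\<^sup>+ x. \<integral>\<^sup>+ y. ennreal (?g y / ln 2) \<partial>count_space ?B \<partial>count_space ?A)"
      by (subst sigma_finite_measure.nn_integral_fst[symmetric])
        (auto simp: sigma_finite_measure_count_space_countable cs)
    also have "(\<integral>\<^sup>+ y. ennreal (?g y / ln 2) \<partial>count_space ?B) = ennreal (1 / ln 2)"
    proof (subst nn_integral_eq_integral)
      show "ennreal (\<integral>y. ?g y / ln 2 \<partial>count_space ?B) = ennreal (1 / ln 2)"
        by (subst integral_divide_zero) (simp add: integral_pmf measure_map_pmf_image del: measure_map_pmf)
    qed (auto intro: integrable_pmf)
    also have "(\<integral>\<^sup>+ x. ennreal (1 / ln 2) \<partial>count_space ?A) < \<infinity>"
      using fin by (simp add: ennreal_mult_less_top of_nat_less_top)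
    finally show "(\<integral>\<^sup>+ z. ennreal (norm (?g (snd z) / ln 2)) \<partial>(count_space ?A \<Otimes>\<^sub>M count_space ?B)) < \<infinity>" .
  qed (simp add: cs)
  then have int: "integrable (count_space (?A \<times> ?B)) h"
    unfolding cs by (rule Bochner_Integration.integrable_bound)
      (use h_nonneg h_le in \<open>fastforce simp: AE_count_space intro: order_trans[OF _ abs_ge_self]\<close>)+
  have "cond_entropy_of p X Y = 0 \<longleftrightarrow> (\<forall>z\<in>?A \<times> ?B. h z = 0)"
    unfolding eq using h_nonneg
    by (subst integral_nonneg_eq_0_iff_AE[OF int]) (auto simp: AE_count_space)
  also have "\<dots> \<longleftrightarrow> (\<forall>z\<in>?A \<times> ?B. ?f z = 0 \<or> ?f z = ?g (snd z))"
  proof (intro ball_cong refl)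
    fix z assume z: "z \<in> ?A \<times> ?B"
    show "h z = 0 \<longleftrightarrow> ?f z = 0 \<or> ?f z = ?g (snd z)"
    proof (cases "?f z = 0")
      case False
      then have "0 < ?f z"
        by (simp add: less_le)
      with gpos[OF z] show ?thesis
        by (simp add: h_def log_def) (rule eq_commute)
    qed (simp add: h_def)
  qed
  also have "\<dots> \<longleftrightarrow> (\<forall>\<omega>\<in>set_pmf p. \<forall>\<omega>'\<in>set_pmf p. Y \<omega> = Y \<omega>' \<longrightarrow> X \<omega> = X \<omega>')"
  proof (intro iffI ballI impI)
    fix \<omega> \<omega>'
    assume *: "\<forall>z\<in>?A \<times> ?B. ?f z = 0 \<or> ?f z = ?g (snd z)"
      and \<omega>: "\<omega> \<in> set_pmf p" "\<omega>' \<in> set_pmf p" "Y \<omega> = Y \<omega>'"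
    show "X \<omega> = X \<omega>'"
    proof (rule ccontr)
      assume ne: "X \<omega> \<noteq> X \<omega>'"
      have "0 < ?f (X \<omega>, Y \<omega>)"
        using \<omega>(1) by (simp add: pmf_positive_iff)
      moreover have "?f (X \<omega>, Y \<omega>) = 0 \<or> ?f (X \<omega>, Y \<omega>) = ?g (snd (X \<omega>, Y \<omega>))"
        using \<omega>(1) by (intro bspec[OF *]) simp
      ultimately have "?f (X \<omega>, Y \<omega>) = ?g (Y \<omega>)"
        by simp
      \<comment> \<open>The outcome \<open>\<omega>'\<close> lies in the fibre of \<open>Y\<close>
        but outside that of the pair, so its positive probability separates the two.\<close>
      moreover have "?f (X \<omega>, Y \<omega>) + pmf p \<omega>' \<le> ?g (Y \<omega>)"
      proof -
        let ?V = "(\<lambda>\<omega>. (X \<omega>, Y \<omega>)) -` {(X \<omega>, Y \<omega>)}"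
        have "measure p ?V + measure p {\<omega>'} = measure p (?V \<union> {\<omega>'})"
          using ne by (intro measure_pmf.finite_measure_Union[symmetric]) auto
        also have "\<dots> \<le> measure p (Y -` {Y \<omega>})"
          using \<omega>(3) by (intro measure_pmf.finite_measure_mono) auto
        finally show ?thesis
          by (simp add: pmf_map measure_pmf_single)
      qed
      ultimately show False
        using pmf_positive[OF \<omega>(2)] by simp
    qed
  next
    fix z
    assume *: "\<forall>\<omega>\<in>set_pmf p. \<forall>\<omega>'\<in>set_pmf p. Y \<omega> = Y \<omega>' \<longrightarrow> X \<omega> = X \<omega>'"
    show "?f z = 0 \<or> ?f z = ?g (snd z)"
    proof (cases "z \<in> (\<lambda>\<omega>. (X \<omega>, Y \<omega>)) ` set_pmf p")
      case True
      then obtain \<omega> where \<omega>: "\<omega> \<in> set_pmf p" "z = (X \<omega>, Y \<omega>)"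
        by auto
      have "?f z = measure p ((\<lambda>\<omega>. (X \<omega>, Y \<omega>)) -` {z} \<inter> set_pmf p)"
        by (simp add: pmf_map measure_Int_set_pmf)
      also have "(\<lambda>\<omega>. (X \<omega>, Y \<omega>)) -` {z} \<inter> set_pmf p = Y -` {snd z} \<inter> set_pmf p"
      proof (rule Set.set_eqI)
        fix \<omega>'
        show "\<omega>' \<in> (\<lambda>\<omega>. (X \<omega>, Y \<omega>)) -` {z} \<inter> set_pmf p
          \<longleftrightarrow> \<omega>' \<in> Y -` {snd z} \<inter> set_pmf p"
          using bspec[OF bspec[OF * \<omega>(1)], of \<omega>'] by (simp add: \<omega>(2)) metis
      qed
      finally show ?thesis
        by (simp add: pmf_map measure_Int_set_pmf)
    qed (auto simp: pmf_eq_0_set_pmf)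
  qed
  finally show ?thesis .
qed

text \<open>Mutual information is the Kullback-Leibler divergence of the joint law from the product
  \<open>P\<close> of the marginals, which is 0 only for equal laws. This criterion needs
  integrability of \<open>D z * log 2 (D z)\<close> for the density \<open>D\<close> of the joint
  law; a finite range of \<open>X\<close> makes \<open>D\<close> bounded.\<close>

lemma mutual_information_pmf_space_eq_0_iff:
  assumes fin: "finite (X ` set_pmf p)"
  shows "prob_space.mutual_information (pmf_space p) 2
      (count_space (X ` set_pmf p)) (count_space (Y ` set_pmf p)) X Y = 0 \<longleftrightarrow>
    map_pmf (\<lambda>\<omega>. (X \<omega>, Y \<omega>)) p = pair_pmf (map_pmf X p) (map_pmf Y p)"
proof -
  let ?A = "X ` set_pmf p" and ?B = "Y ` set_pmf p"
  let ?q = "pair_pmf (map_pmf X p) (map_pmf Y p)" and ?r = "map_pmf (\<lambda>\<omega>. (X \<omega>, Y \<omega>)) p"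
  interpret information_space "pmf_space p" 2
    by (rule information_space_pmf_space)
  have cs: "count_space ?A \<Otimes>\<^sub>M count_space ?B = count_space (?A \<times> ?B)"
    by (simp add: pair_measure_countable)
  define P where "P = density (count_space (?A \<times> ?B)) (\<lambda>z. ennreal (pmf ?q z))"
  define D where "D = (\<lambda>z. pmf ?r z / pmf ?q z)"
  have distr: "distr (pmf_space p) (count_space ?A) X \<Otimes>\<^sub>M distr (pmf_space p) (count_space ?B) Y = P"
  proof -
    interpret B: prob_space "distr (pmf_space p) (count_space ?B) Y"
      by (rule prob_space_distr) simp
    note dX = distributed_distr_eq_density[OF distributed_pmf_space[of X p ?A]]
      and dY = distributed_distr_eq_density[OF distributed_pmf_space[of Y p ?B]]
    have "distr (pmf_space p) (count_space ?A) X \<Otimes>\<^sub>M distr (pmf_space p) (count_space ?B) Y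
      = density (count_space ?A \<Otimes>\<^sub>M count_space ?B)
          (\<lambda>(x, y). ennreal (pmf (map_pmf X p) x) * ennreal (pmf (map_pmf Y p) y))"
      using B.sigma_finite_measure_axioms
      by (subst dX, simp, simp, subst dY, simp, simp, subst pair_measure_density)
        (auto simp: dY sigma_finite_measure_count_space_countable)
    also have "\<dots> = P"
      unfolding P_def cs by (intro density_cong) (auto simp: pmf_pair ennreal_mult)
    finally show ?thesis .
  qed
  have qpos: "0 < pmf ?q z" if "z \<in> ?A \<times> ?B" for z
    using that by (simp add: pmf_positive_iff)
  have dr: "distr (pmf_space p) (count_space ?A \<Otimes>\<^sub>M count_space ?B) (\<lambda>\<omega>. (X \<omega>, Y \<omega>))
      = density (count_space (?A \<times> ?B)) (\<lambda>z. ennreal (pmf ?r z))"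
    unfolding cs by (rule distributed_distr_eq_density[OF distributed_pmf_space]) auto
  also have dens: "\<dots> = density P D"
    unfolding P_def D_def
    by (subst density_density_eq)
      (use qpos in \<open>fastforce intro!: density_cong simp: AE_count_space ennreal_mult[symmetric]\<close>)+
  finally have dr': "distr (pmf_space p) (count_space ?A \<Otimes>\<^sub>M count_space ?B) (\<lambda>\<omega>. (X \<omega>, Y \<omega>)) = density P D" .
  have prob_P: "prob_space P"
  proof -
    interpret A: prob_space "distr (pmf_space p) (count_space ?A) X"
      by (rule prob_space_distr) simp
    interpret B: prob_space "distr (pmf_space p) (count_space ?B) Y"
      by (rule prob_space_distr) simp
    interpret AB: pair_prob_space "distr (pmf_space p) (count_space ?A) X" "distr (pmf_space p) (count_space ?B) Y" ..
    show ?thesis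
      unfolding distr[symmetric] by (rule AB.prob_space_axioms)
  qed
  interpret P: prob_space P by fact
  interpret P: information_space P 2 by unfold_locales simp
  have D_nonneg: "0 \<le> D z" for z
    by (simp add: D_def)
  \<comment> \<open>The joint probability is at most the \<open>Y\<close>-marginal, so
    \<open>D\<close> is at most the reciprocal of the \<open>X\<close>-marginal, and there are
    finitely many of these.\<close>
  define c where "c = (MAX x\<in>?A. 1 / pmf (map_pmf X p) x)"
  have D_le: "D z \<le> c" if "z \<in> ?A \<times> ?B" for z
  proof -
    have pos: "0 < pmf (map_pmf X p) (fst z)" "0 < pmf (map_pmf Y p) (snd z)"
      using that by (auto simp: pmf_positive_iff)
    have "pmf ?r z \<le> pmf (map_pmf Y p) (snd z)"
      by (auto simp: pmf_map intro!: measure_pmf.finite_measure_mono)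
    then have "D z \<le> 1 / pmf (map_pmf X p) (fst z)"
      using pos by (cases z) (simp add: D_def pmf_pair field_simps)
    also have "\<dots> \<le> c"
      unfolding c_def using fin that by (intro Max_ge) auto
    finally show ?thesis .
  qed
  have space_P: "space P = ?A \<times> ?B"
    by (simp add: P_def)
  have sets_P: "sets P = Pow (?A \<times> ?B)"
    by (simp add: P_def)
  have mP: "f \<in> borel_measurable P" for f :: "_ \<Rightarrow> real"
    by (simp add: P_def)
  \<comment> \<open>Both signs are covered: ln t \<le> t gives t ln t \<le> c^2, and ln (1 / t)
    \<le> 1 / t gives - t ln t \<le> 1.\<close>
  have bound: "\<bar>t * log 2 t\<bar> \<le> (1 + c\<^sup>2) / ln 2" if t: "0 \<le> t" "t \<le> c" for t :: real
  proof (cases "t = 0")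
    case False
    then have "0 < t" using t by simp
    have "t * ln t \<le> t * t"
      using \<open>0 < t\<close> ln_le_minus_one[of t] by (intro mult_left_mono) auto
    also have "\<dots> \<le> c\<^sup>2"
      unfolding power2_eq_square using t by (intro mult_mono) auto
    finally have 1: "t * ln t \<le> 1 + c\<^sup>2" by simp
    have "- ln t = ln (1 / t)"
      using \<open>0 < t\<close> by (simp add: ln_div)
    also have "\<dots> \<le> 1 / t"
      using \<open>0 < t\<close> ln_le_minus_one[of "1 / t"] by simp
    finally have "t * - ln t \<le> t * (1 / t)"
      using \<open>0 < t\<close> by (intro mult_left_mono) auto
    then have 2: "- (t * ln t) \<le> 1 + c\<^sup>2"
      using \<open>0 < t\<close> by simp (smt (verit) zero_le_power2)
    have "\<bar>t * ln t\<bar> \<le> 1 + c\<^sup>2"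
      using 1 2 by simp
    then have "\<bar>t * ln t\<bar> / ln 2 \<le> (1 + c\<^sup>2) / ln 2"
      by (intro divide_right_mono) auto
    then show ?thesis
      by (simp add: log_def abs_mult)
  qed simp
  have int: "integrable P (\<lambda>z. D z * log 2 (D z))"
    by (rule P.integrable_const_bound[of _ "(1 + c\<^sup>2) / ln 2"])
      (use bound D_nonneg D_le mP in \<open>auto intro!: AE_I2 simp: space_P\<close>)
  have "prob_space (density P D)"
    unfolding dr'[symmetric] by (rule prob_space_distr) (auto simp: cs)
  then have "mutual_information 2 (count_space ?A) (count_space ?B) X Y = 0 \<longleftrightarrow> density P D = P"
    unfolding mutual_information_def distr dr'
    by (intro P.KL_eq_0_iff_eq int mP AE_I2 D_nonneg)
  also have "\<dots> \<longleftrightarrow> ?r = ?q"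
  proof
    assume eq: "density P D = P"
    show "?r = ?q"
    proof (rule pmf_eqI)
      fix z
      show "pmf ?r z = pmf ?q z"
      proof (cases "z \<in> ?A \<times> ?B")
        case True
        have "emeasure (density (count_space (?A \<times> ?B)) (\<lambda>z. ennreal (pmf ?r z))) {z}
          = emeasure P {z}"
          by (simp add: dens eq)
        then show ?thesis
          using True unfolding P_def
          by (simp add: emeasure_density nn_integral_count_space_indicator[symmetric]
              nn_integral_indicator_finite indicator_eq_0_iff)
      next
        case False
        then have "z \<notin> set_pmf ?r" "z \<notin> set_pmf ?q"
          by auto
        then show ?thesis
          unfolding pmf_eq_0_set_pmf[symmetric] by simp
      qed
    qed
  next
    assume "?r = ?q"
    then show "density P D = P"
      unfolding dens[symmetric] by (simp add: P_def)
  qed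
  finally show ?thesis .
qed

text \<open>By the chain rule I(X; Y | Z) = I(X; (Y, Z)) - I(X; Z). For constant \<open>Z\<close>
  the last term is 0, and attaching a constant to \<open>Y\<close> is an injective relabelling. In
  Model I the indicator is such a constant.\<close>

lemma cond_mutual_info_of_eq_0_iff:
  assumes fin: "finite (X ` set_pmf p)" and Z: "\<And>\<omega>. \<omega> \<in> set_pmf p \<Longrightarrow> Z \<omega> = z"
  shows "cond_mutual_info_of p X Y Z = 0 \<longleftrightarrow>
    map_pmf (\<lambda>\<omega>. (X \<omega>, Y \<omega>)) p = pair_pmf (map_pmf X p) (map_pmf Y p)"
proof -
  interpret information_space "pmf_space p" 2
    by (rule information_space_pmf_space)
  have ZA: "Z ` set_pmf p = {z}"
    using Z set_pmf_not_empty[of p] by auto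
  have "count_space (Y ` set_pmf p) \<Otimes>\<^sub>M count_space (Z ` set_pmf p)
      = count_space ((\<lambda>\<omega>. (Y \<omega>, Z \<omega>)) ` set_pmf p)"
    using Z by (subst pair_measure_countable) (auto simp: ZA intro!: arg_cong[where f = count_space])
  moreover have "mutual_information 2 (count_space (X ` set_pmf p)) (count_space (Z ` set_pmf p)) X Z = 0"
  proof -
    have "map_pmf Z p = return_pmf z"
      using Z by (simp add: map_pmf_cong[of p p Z "\<lambda>_. z"] map_pmf_const)
    moreover have "map_pmf (\<lambda>\<omega>. (X \<omega>, Z \<omega>)) p = map_pmf (\<lambda>\<omega>. (X \<omega>, z)) p"
      using Z by (intro map_pmf_cong) auto
    ultimately show ?thesis
      unfolding mutual_information_pmf_space_eq_0_iff[OF fin]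
      by (simp add: pair_return_pmf2 map_pmf_comp)
  qed
  ultimately have "cond_mutual_info_of p X Y Z = 0 \<longleftrightarrow>
      map_pmf (\<lambda>\<omega>. (X \<omega>, Y \<omega>, Z \<omega>)) p = pair_pmf (map_pmf X p) (map_pmf (\<lambda>\<omega>. (Y \<omega>, Z \<omega>)) p)"
    unfolding cond_mutual_info_of_def conditional_mutual_information_def
    by (simp only: mutual_information_pmf_space_eq_0_iff[OF fin, of "\<lambda>\<omega>. (Y \<omega>, Z \<omega>)"] diff_zero)
  also have "map_pmf (\<lambda>\<omega>. (X \<omega>, Y \<omega>, Z \<omega>)) p
      = map_pmf (apsnd (\<lambda>y. (y, z))) (map_pmf (\<lambda>\<omega>. (X \<omega>, Y \<omega>)) p)"
    unfolding map_pmf_comp using Z by (intro map_pmf_cong) auto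
  also have "map_pmf (\<lambda>\<omega>. (Y \<omega>, Z \<omega>)) p = map_pmf (\<lambda>y. (y, z)) (map_pmf Y p)"
    unfolding map_pmf_comp using Z by (intro map_pmf_cong) auto
  also have "pair_pmf (map_pmf X p) (map_pmf (\<lambda>y. (y, z)) (map_pmf Y p))
      = map_pmf (apsnd (\<lambda>y. (y, z))) (pair_pmf (map_pmf X p) (map_pmf Y p))"
    by (rule pair_map_pmf2)
  also have "map_pmf (apsnd (\<lambda>y. (y, z))) (map_pmf (\<lambda>\<omega>. (X \<omega>, Y \<omega>)) p)
        = map_pmf (apsnd (\<lambda>y. (y, z))) (pair_pmf (map_pmf X p) (map_pmf Y p)) \<longleftrightarrow>
      map_pmf (\<lambda>\<omega>. (X \<omega>, Y \<omega>)) p = pair_pmf (map_pmf X p) (map_pmf Y p)"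
    by (intro inj_eq pmf.inj_map injI) (auto simp: apsnd_def map_prod_def split: prod.splits)
  finally show ?thesis .
qed

section \<open>The converse bound\<close>

lemma pmf_bind_le:
  assumes "\<And>x. x \<in> set_pmf p \<Longrightarrow> pmf (f x) a \<le> c"
  shows "pmf (bind_pmf p f) a \<le> c"
proof -
  have "pmf (bind_pmf p f) a \<le> measure_pmf.expectation p (\<lambda>_. c)"
    unfolding pmf_bind using assms
    by (intro integral_mono_AE)
      (auto simp: AE_measure_pmf_iff pmf_le_1 intro!: measure_pmf.integrable_const_bound[of _ 1])
  then show ?thesis by simp
qed

context pcsi_I
begin

section \<open>The joint law of a protocol\<close>

lemma finite_supports: "finite supports"
  unfolding supports_def by simp

lemma supports_not_empty: "M \<le> K \<Longrightarrow> supports \<noteq> {}"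
  unfolding supports_def using obtain_subset_with_card_n[of M "{1..K}"] by auto

lemma finite_Fq: "finite Fq" and Fq_subset: "Fq \<subseteq> carrier F"
  and one_in_Fq: "\<one> \<in> Fq"
proof -
  show "finite Fq"
    using card_Fq primepow_gt_0_nat[OF primepow_q] card_gt_0_iff by metis
  show "Fq \<subseteq> carrier F" "\<one> \<in> Fq"
    using subfieldE(1,3)[OF subfield_Fq] subringE(1,3)[of Fq F] by blast+
qed

lemma finite_carrier: "finite (carrier F)"
  using card_F primepow_gt_0_nat[OF primepow_q] card_gt_0_iff[of "carrier F"] by simp

lemma finite_coeff_seqs: "finite coeff_seqs"
  unfolding coeff_seqs_def by (rule finite_lists_length_eq) (simp add: finite_Fq)

lemma coeff_seqs_not_empty: "coeff_seqs \<noteq> {}"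
proof -
  have "replicate M \<one> \<in> coeff_seqs"
    using one_in_Fq one_not_zero by (auto simp: coeff_seqs_def set_replicate_conv_if)
  then show ?thesis by auto
qed

lemma finite_messages: "finite messages"
  unfolding messages_def by (intro finite_PiE) (auto simp: finite_carrier)

lemma card_messages: "card messages = (q ^ l) ^ K"
  unfolding messages_def by (simp add: card_funcsetE card_F)

lemma messages_not_empty: "messages \<noteq> {}"
  using card_messages primepow_gt_0_nat[OF primepow_q] by auto

lemma demands_not_empty: "M < K \<Longrightarrow> S \<in> supports \<Longrightarrow> {1..K} - S \<noteq> {}"
  unfolding supports_def using card_mono[of S "{1..K}"] finite_subset[of S "{1..K}"] by fastforce

lemma set_pmf_joint:
  assumes "M < K"
  shows "set_pmf joint = {(W, S, C, X, Q). S \<in> supports \<and> W \<in> {1..K} - S \<and> C \<in> coeff_seqs \<and>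
    X \<in> messages \<and> Q \<in> set_pmf (query W S C)}"
  using assms supports_not_empty demands_not_empty
  by (auto simp: joint_def finite_supports finite_coeff_seqs coeff_seqs_not_empty
      finite_messages messages_not_empty cong: SUP_cong_simp)

lemma rv_theta_joint: "M < K \<Longrightarrow> \<omega> \<in> set_pmf joint \<Longrightarrow> rv_theta \<omega> = 0"
  by (auto simp: set_pmf_joint rv_theta_def rv_W_def rv_S_def)

text \<open>Demands are drawn outside the support, so the conditioning event in \<open>rate\<close>
  has probability 1.\<close>

lemma cond_pmf_joint:
  assumes "M < K"
  shows "cond_pmf joint {\<omega>. rv_theta \<omega> = 0} = joint"
proof (rule pmf_eqI)
  fix \<omega>
  let ?E = "{\<omega>. rv_theta \<omega> = 0}"
  have sub: "set_pmf joint \<subseteq> ?E"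
    using rv_theta_joint[OF assms] by blast
  then have ne: "set_pmf joint \<inter> ?E \<noteq> {}"
    using set_pmf_not_empty[of joint] by blast
  have "AE \<omega> in joint. \<omega> \<in> ?E"
    unfolding AE_measure_pmf_iff using sub by blast
  then have one: "measure joint ?E = 1"
    by (intro measure_pmf.prob_eq_1[THEN iffD2]) simp
  have zero: "pmf joint \<omega> = 0" if "\<omega> \<notin> ?E"
    unfolding pmf_eq_0_set_pmf using sub that by blast
  show "pmf (cond_pmf joint ?E) \<omega> = pmf joint \<omega>"
    unfolding pmf_cond[OF ne] one using zero by (cases "\<omega> \<in> ?E") simp_all
qed

lemma WS_private_iff:
  assumes "M < K"
  shows "WS_private \<longleftrightarrow> map_pmf (\<lambda>\<omega>. ((rv_W \<omega>, rv_S \<omega>), rv_Q \<omega>)) joint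
    = pair_pmf (map_pmf (\<lambda>\<omega>. (rv_W \<omega>, rv_S \<omega>)) joint) (map_pmf rv_Q joint)"
proof -
  have "(\<lambda>\<omega>. (rv_W \<omega>, rv_S \<omega>)) ` set_pmf joint \<subseteq> {1..K} \<times> supports"
    using assms by (auto simp: set_pmf_joint rv_W_def rv_S_def)
  then have "finite ((\<lambda>\<omega>. (rv_W \<omega>, rv_S \<omega>)) ` set_pmf joint)"
    by (rule finite_subset) (simp add: finite_supports)
  then show ?thesis
    unfolding WS_private_def using rv_theta_joint[OF assms]
    by (intro cond_mutual_info_of_eq_0_iff)
qed

text \<open>Zero conditional entropy means that outcomes with equal observations have equal wanted
  messages. Such outcomes share \<open>W\<close>, \<open>S\<close>, \<open>C\<close> and
  \<open>Q\<close>, so only their message vectors are compared.\<close>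

lemma recoverable_iff:
  assumes "M < K"
  shows "recoverable \<longleftrightarrow> (\<forall>W S C Q X X'. (W, S, C, X, Q) \<in> set_pmf joint \<longrightarrow>
    (W, S, C, X', Q) \<in> set_pmf joint \<longrightarrow> answer Q 0 X = answer Q 0 X' \<longrightarrow>
    rv_Y (W, S, C, X, Q) = rv_Y (W, S, C, X', Q) \<longrightarrow> X W = X' W)"
proof -
  have "(\<lambda>\<omega>. rv_X \<omega> (rv_W \<omega>)) ` set_pmf joint \<subseteq> carrier F"
    using assms by (auto simp: set_pmf_joint rv_X_def rv_W_def messages_def)
  then have fin: "finite ((\<lambda>\<omega>. rv_X \<omega> (rv_W \<omega>)) ` set_pmf joint)"
    by (rule finite_subset) (rule finite_carrier)
  have A: "rv_A \<omega> = answer (rv_Q \<omega>) 0 (rv_X \<omega>)" if "\<omega> \<in> set_pmf joint" for \<omega>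
    using rv_theta_joint[OF assms that] by (simp add: rv_A_def)
  show ?thesis
    unfolding recoverable_def cond_entropy_of_eq_0_iff[OF fin]
    using rv_theta_joint[OF assms]
    by (fastforce simp: A rv_W_def rv_S_def rv_C_def rv_X_def rv_Q_def split: prod.splits)
qed

section \<open>Counting the message vectors behind an answer\<close>

lemma card_answer_fiber_le:
  assumes "M < K" "WS_private" "recoverable" and Q: "Q \<in> rv_Q ` set_pmf joint"
  shows "card {X \<in> messages. answer Q 0 X = a} \<le> (q ^ l) ^ M"
proof -
  \<comment> \<open>Any support would do, since privacy makes each one compatible with every query
    that occurs.\<close>
  define S where "S = {1..M}"
  have S: "S \<in> supports"
    using \<open>M < K\<close> by (auto simp: supports_def S_def)
  then have "finite S"
    by (simp add: S_def)
  \<comment> \<open>Under a product law, \<open>(W, S)\<close> and \<open>Q\<close>, each of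
    positive probability, also occur together. The coefficients \<open>C\<close> behind
    \<open>Q\<close> may vary with \<open>W\<close>.\<close>
  have query: "\<exists>C\<in>coeff_seqs. Q \<in> set_pmf (query W S C)" if "W \<in> {1..K} - S" for W
  proof -
    obtain C X where "C \<in> coeff_seqs" "X \<in> messages"
      using coeff_seqs_not_empty messages_not_empty by blast
    moreover obtain Q' where "Q' \<in> set_pmf (query W S C)"
      using set_pmf_not_empty by fast
    ultimately have "(W, S, C, X, Q') \<in> set_pmf joint"
      using \<open>M < K\<close> S that by (simp add: set_pmf_joint)
    then have "(W, S) \<in> (\<lambda>\<omega>. (rv_W \<omega>, rv_S \<omega>)) ` set_pmf joint"
      by (force simp: rv_W_def rv_S_def)
    with Q have "((W, S), Q) \<in> set_pmf (pair_pmf (map_pmf (\<lambda>\<omega>. (rv_W \<omega>, rv_S \<omega>)) joint) (map_pmf rv_Q joint))"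
      by simp
    also have "pair_pmf (map_pmf (\<lambda>\<omega>. (rv_W \<omega>, rv_S \<omega>)) joint) (map_pmf rv_Q joint)
        = map_pmf (\<lambda>\<omega>. ((rv_W \<omega>, rv_S \<omega>), rv_Q \<omega>)) joint"
      using assms(1,2) by (simp add: WS_private_iff)
    finally show ?thesis
      using \<open>M < K\<close> by (auto simp: set_pmf_joint rv_W_def rv_S_def rv_Q_def)
  qed
  have "inj_on (\<lambda>X. restrict X S) {X \<in> messages. answer Q 0 X = a}"
  proof (rule inj_onI, clarsimp)
    fix X X'
    assume X: "X \<in> messages" "X' \<in> messages" "answer Q 0 X' = answer Q 0 X"
      and eq: "restrict X S = restrict X' S"
    have onS: "X i = X' i" if "i \<in> S" for i
      using fun_cong[OF eq, of i] that by simp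
    have "X i = X' i" if i: "i \<in> {1..K}" for i
    proof (cases "i \<in> S")
      case False
      \<comment> \<open>Recoverability for the demand \<open>i\<close> needs equal side information.
        This holds because \<open>rv_Y\<close> involves only messages in \<open>S\<close>, where
        \<open>X\<close> and \<open>X'\<close> agree.\<close>
      then obtain C where C: "C \<in> coeff_seqs" "Q \<in> set_pmf (query i S C)"
        using query i by blast
      have idx: "sorted_list_of_set S ! j \<in> S" if "j < M" for j
        using that nth_mem[of j "sorted_list_of_set S"] \<open>finite S\<close> by (simp add: S_def)
      have "C ! j \<in> carrier F" if "j < M" for j
      proof -
        have "C ! j \<in> set C"
          using C that by (simp add: coeff_seqs_def)
        then show ?thesis
          using C Fq_subset unfolding coeff_seqs_def by blast
      qed
      moreover have "X' (sorted_list_of_set S ! j) \<in> carrier F" if "j < M" for j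
        using idx[OF that] X \<open>M < K\<close> by (auto simp: messages_def S_def)
      ultimately have Y: "rv_Y (i, S, C, X, Q) = rv_Y (i, S, C, X', Q)"
        unfolding rv_Y_def rv_C_def rv_X_def rv_S_def prod.case
        by (intro finsum_cong' refl) (auto simp: onS[OF idx])
      have "(i, S, C, X, Q) \<in> set_pmf joint" "(i, S, C, X', Q) \<in> set_pmf joint"
        using C i False S X \<open>M < K\<close> by (auto simp: set_pmf_joint)
      then show ?thesis
        using assms(1,3) X(3) Y recoverable_iff by metis
    qed (rule onS)
    then show "X = X'"
      using X(1,2) unfolding messages_def by (intro PiE_ext[of X _ _ X']) auto
  qed
  moreover have "(\<lambda>X. restrict X S) ` {X \<in> messages. answer Q 0 X = a} \<subseteq> S \<rightarrow>\<^sub>E carrier F"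
    using \<open>M < K\<close> by (auto simp: messages_def S_def)
  moreover have "finite (S \<rightarrow>\<^sub>E carrier F)"
    using \<open>finite S\<close> finite_carrier by (intro finite_PiE) auto
  ultimately have "card {X \<in> messages. answer Q 0 X = a} \<le> card (S \<rightarrow>\<^sub>E carrier F)"
    by (rule card_inj_on_le)
  also have "\<dots> = (q ^ l) ^ M"
    using \<open>finite S\<close> by (simp add: card_funcsetE card_F S_def)
  finally show ?thesis .
qed

lemma pmf_answer_le:
  assumes "M < K" "WS_private" "recoverable"
  shows "pmf (map_pmf rv_A joint) a \<le> 1 / real (q ^ l) ^ (K - M)"
proof -
  define N where "N = real (q ^ l)"
  have N: "0 < N"
    using primepow_gt_0_nat[OF primepow_q] by (simp add: N_def)
  have "map_pmf rv_A joint = map_pmf (\<lambda>\<omega>. answer (rv_Q \<omega>) 0 (rv_X \<omega>)) joint"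
    using rv_theta_joint[OF \<open>M < K\<close>] by (intro map_pmf_cong) (auto simp: rv_A_def)
  \<comment> \<open>The query does not see the messages, so the two draws commute. For a fixed query
    the messages are then uniform, and an answer has probability fibre size over
    \<open>(q ^ l) ^ K\<close>.\<close>
  also have "\<dots> = do {
     S \<leftarrow> pmf_of_set supports;
     W \<leftarrow> pmf_of_set ({1..K} - S);
     C \<leftarrow> pmf_of_set coeff_seqs;
     Q \<leftarrow> query W S C;
     X \<leftarrow> pmf_of_set messages;
     return_pmf (answer Q 0 X)
   }"
    unfolding joint_def
    by (simp add: map_bind_pmf rv_Q_def rv_X_def bind_commute_pmf[of "pmf_of_set messages"])
  also have "pmf \<dots> a \<le> 1 / N ^ (K - M)"
  proof (rule pmf_bind_le, rule pmf_bind_le, rule pmf_bind_le, rule pmf_bind_le)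
    fix S W C Q
    assume *: "S \<in> set_pmf (pmf_of_set supports)" "W \<in> set_pmf (pmf_of_set ({1..K} - S))"
      "C \<in> set_pmf (pmf_of_set coeff_seqs)" "Q \<in> set_pmf (query W S C)"
    obtain X where "X \<in> messages"
      using messages_not_empty by blast
    with * have "(W, S, C, X, Q) \<in> set_pmf joint"
      using \<open>M < K\<close> supports_not_empty demands_not_empty
      by (simp add: set_pmf_joint finite_supports finite_coeff_seqs coeff_seqs_not_empty)
    then have "Q \<in> rv_Q ` set_pmf joint"
      by (force simp: rv_Q_def)
    then have card: "card {X \<in> messages. answer Q 0 X = a} \<le> (q ^ l) ^ M"
      by (rule card_answer_fiber_le[OF assms])
    have "pmf (pmf_of_set messages \<bind> (\<lambda>X. return_pmf (answer Q 0 X))) a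
        = pmf (map_pmf (answer Q 0) (pmf_of_set messages)) a"
      by (simp add: map_pmf_def)
    also have "\<dots> = real (card {X \<in> messages. answer Q 0 X = a}) / real (card messages)"
      by (simp add: pmf_map measure_pmf_of_set finite_messages messages_not_empty vimage_def Int_def)
    also have "\<dots> \<le> N ^ M / N ^ K"
      using card N unfolding card_messages N_def
      by (intro frac_le) (auto simp flip: of_nat_power)
    also have "\<dots> = 1 / N ^ (K - M)"
      using N \<open>M < K\<close> by (simp add: power_diff)
    finally show "pmf (pmf_of_set messages \<bind> (\<lambda>X. return_pmf (answer Q 0 X))) a \<le> 1 / N ^ (K - M)" .
  qed
  finally show ?thesis
    by (simp add: N_def)
qed

lemma entropy_answer_eq_0_or_ge:
  assumes "M < K" "WS_private" "recoverable"
  shows "infinite (rv_A ` set_pmf joint) \<and> entropy_of joint rv_A = 0 \<or>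
    (real K - real M) * (real l * log 2 (real q)) \<le> entropy_of joint rv_A"
proof -
  have "- log 2 (1 / real (q ^ l) ^ (K - M)) = (real K - real M) * (real l * log 2 (real q))"
    using \<open>M < K\<close> primepow_gt_0_nat[OF primepow_q]
    by (simp add: log_divide log_nat_power of_nat_diff)
  then show ?thesis
    using entropy_of_eq_0_or_ge[OF pmf_answer_le[OF assms]] by simp
qed

lemma rate_le:
  assumes "M < K" "WS_private" "recoverable"
  shows "rate \<le> 1 / (real K - real M)"
proof -
  have L: "0 < real l * log 2 (real q)"
    using primepow_gt_Suc_0[OF primepow_q] l_pos by simp
  \<comment> \<open>The value 0 is the default for infinite entropy; division by it gives rate 0,
    below the bound.\<close>
  have "entropy_of joint rv_A = 0 \<or>
      (real K - real M) * (real l * log 2 (real q)) \<le> entropy_of joint rv_A"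
    using entropy_answer_eq_0_or_ge[OF assms] by blast
  then show ?thesis
  proof
    assume le: "(real K - real M) * (real l * log 2 (real q)) \<le> entropy_of joint rv_A"
    have "0 < (real K - real M) * (real l * log 2 (real q))"
      using L \<open>M < K\<close> by simp
    then show ?thesis
      using le L \<open>M < K\<close> by (simp add: rate_def cond_pmf_joint field_simps)
  qed (use \<open>M < K\<close> in \<open>simp add: rate_def cond_pmf_joint\<close>)
qed

text \<open>The logarithm of the number of possible answers bounds the entropy from above and here
  meets the converse bound. Finiteness of \<open>B\<close> excludes the default value 0.\<close>

lemma rate_eq:
  assumes "M < K" "WS_private" "recoverable"
    and B: "rv_A ` set_pmf joint \<subseteq> B" "finite B" "card B = (q ^ l) ^ (K - M)"
  shows "rate = 1 / (real K - real M)"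
proof -
  have "entropy_of joint rv_A \<le> log 2 (card B)"
    by (rule entropy_of_le_log_card[OF B(1,2)])
  also have "\<dots> = (real K - real M) * (real l * log 2 (real q))"
    using \<open>M < K\<close> primepow_gt_0_nat[OF primepow_q]
    by (simp add: B(3) log_nat_power of_nat_diff)
  moreover have "finite (rv_A ` set_pmf joint)"
    using B finite_subset by blast
  ultimately have "entropy_of joint rv_A = (real K - real M) * (real l * log 2 (real q))"
    using entropy_answer_eq_0_or_ge[OF assms(1-3)] by auto
  moreover have "0 < real l * log 2 (real q)"
    using primepow_gt_Suc_0[OF primepow_q] l_pos by simp
  ultimately show ?thesis
    unfolding rate_def cond_pmf_joint[OF \<open>M < K\<close>]
    by (simp only: nonzero_divide_mult_cancel_right less_imp_neq[symmetric] not_False_eq_True)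
qed

end

section \<open>The Reed-Solomon scheme\<close>

lemma pair_pmf_of_set:
  assumes "finite A" "A \<noteq> {}" "finite B" "B \<noteq> {}"
  shows "pair_pmf (pmf_of_set A) (pmf_of_set B) = pmf_of_set (A \<times> B)"
proof (rule pmf_eqI)
  fix z
  show "pmf (pair_pmf (pmf_of_set A) (pmf_of_set B)) z = pmf (pmf_of_set (A \<times> B)) z"
    using assms by (cases z) (simp add: pmf_pair indicator_def)
qed

text \<open>The coefficients do not depend on \<open>x\<close>, so a locator becomes one fixed
  combination of the powers in the answer. Working over the integers postpones reduction modulo a
  prime.\<close>

lemma prod_linear_eq_sum_powers:
  fixes R :: "int set"
  shows "\<exists>a. \<forall>x. (\<Prod>r\<in>R. x - r) = (\<Sum>j\<le>card R. a j * x ^ j)"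
proof -
  define P where "P = (\<Prod>r\<in>R. [:- r, 1:])"
  have "Polynomial.degree P = card R"
    unfolding P_def by (subst degree_prod_eq_sum_degree) auto
  moreover have "poly P x = (\<Prod>r\<in>R. x - r)" for x
    unfolding P_def by (simp add: poly_prod)
  ultimately have "\<forall>x. (\<Prod>r\<in>R. x - r) = (\<Sum>j\<le>card R. Polynomial.coeff P j * x ^ j)"
    by (metis poly_altdef)
  then show ?thesis by blast
qed

lemma sum_mod_cong:
  fixes f g :: "'a \<Rightarrow> int"
  assumes "\<And>i. i \<in> A \<Longrightarrow> f i mod m = g i mod m"
  shows "sum f A mod m = sum g A mod m"
  by (subst (1 2) mod_sum_eq[symmetric]) (simp add: assms)

text \<open>The assumption \<open>K_less\<close> keeps the evaluation points 1, ..., K distinct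
  modulo \<open>p\<close>.\<close>

locale reed_solomon_scheme =
  fixes p K M :: nat
  assumes prime_p: "prime p" and K_less: "K < p" and M_less: "M < K"
begin

sublocale residues_prime p "residue_ring (int p)"
  by unfold_locales (rule prime_p)

abbreviation units :: "int set" where
  "units \<equiv> {1..<int p}"

lemma card_units: "card units = p - 1"
  by (simp add: nat_diff_distrib)

text \<open>A query is the number of a multiplier vector in an enumeration. \<open>locator W S\<close> is a polynomial of
  degree \<open>K - M - 1\<close>, so its values are combinations of the powers \<open>i ^ j\<close> occurring in the
  answer.\<close>

definition multipliers :: "(nat \<Rightarrow> int) set" where
  "multipliers = {1..K} \<rightarrow>\<^sub>E units"

definition locator :: "nat \<Rightarrow> nat set \<Rightarrow> nat \<Rightarrow> int" where
  "locator W S i = (\<Prod>r\<in>{1..K} - insert W S. int i - int r)"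

text \<open>The first component lists the entries on \<open>S\<close> of the codeword with support
  \<open>insert W S\<close>, in the index order of \<open>rv_Y\<close>; they become the side
  information coefficients. The second is the free randomness. A query is formed by inverting this
  map.\<close>

definition split_multipliers :: "nat \<Rightarrow> nat set \<Rightarrow> (nat \<Rightarrow> int) \<Rightarrow> int list \<times> (nat \<Rightarrow> int)" where
  "split_multipliers W S v =
    (map (\<lambda>i. v i * locator W S i mod int p) (sorted_list_of_set S), restrict v ({1..K} - S))"

definition rs_query :: "nat \<Rightarrow> nat set \<Rightarrow> int list \<Rightarrow> nat pmf" where
  "rs_query W S C =
    map_pmf (\<lambda>u. to_nat_on multipliers (inv_into multipliers (split_multipliers W S) (C, u)))
      (pmf_of_set (({1..K} - S) \<rightarrow>\<^sub>E units))"

definition rs_answer :: "nat \<Rightarrow> nat \<Rightarrow> (nat \<Rightarrow> int) \<Rightarrow> int list" where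
  "rs_answer Q \<theta> X =
    map (\<lambda>j. (\<Sum>i\<in>{1..K}. from_nat_into multipliers Q i * int i ^ j * X i) mod int p) [0..<K - M]"

lemma carrier_eq: "carrier (residue_ring (int p)) = {0..<int p}"
  by (auto simp: res_carrier_eq)

text \<open>With \<open>l = 1\<close> the prime field serves both as message field and as
  coefficient field.\<close>

sublocale pcsi_I "residue_ring (int p)" "{0..<int p}" p 1 K M rs_query rs_answer
proof (intro pcsi_I.intro pcsi_I_axioms.intro is_field)
  show "subfield {0..<int p} (residue_ring (int p))"
    using carrier_is_subfield by (simp add: carrier_eq)
qed (use prime_p in \<open>auto simp: carrier_eq\<close>)

section \<open>Arithmetic of locators and multipliers modulo p\<close>

lemma coeff_seqs_eq: "coeff_seqs = {C. set C \<subseteq> units \<and> length C = M}"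
proof -
  have "{0..<int p} - {0} = units" by auto
  then show ?thesis
    by (simp add: coeff_seqs_def res_zero_eq)
qed

lemma units_iff: "x mod int p \<in> units \<longleftrightarrow> \<not> int p dvd x"
proof -
  have "0 \<le> x mod int p" "x mod int p < int p"
    using K_less by simp_all
  then show ?thesis
    unfolding dvd_eq_mod_eq_0 by (simp; linarith)
qed

lemma not_dvd_unit: "x \<in> units \<Longrightarrow> \<not> int p dvd x"
  using zdvd_not_zless[of x "int p"] by auto

lemma prime_int_p: "prime (int p)"
  using prime_p by simp

text \<open>Each factor is a nonzero difference of two points of \<open>{1..K}\<close>, hence
  smaller than \<open>p\<close> in absolute value, and a prime dividing the product would divide a
  factor.\<close>

lemma not_dvd_locator:
  assumes "i \<in> {1..K}" "i \<in> insert W S"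
  shows "\<not> int p dvd locator W S i"
proof
  assume "int p dvd locator W S i"
  then have "\<exists>r\<in>{1..K} - insert W S. int p dvd int i - int r"
    unfolding locator_def by (subst (asm) prime_dvd_prod_iff[OF _ prime_int_p]) simp_all
  then obtain r where r: "r \<in> {1..K} - insert W S" "int p dvd int i - int r"
    by blast
  have "i \<noteq> r"
    using r(1) assms(2) by blast
  moreover have "\<bar>int i - int r\<bar> < int p"
    using r(1) assms(1) K_less by (simp; linarith)
  ultimately show False
    using dvd_imp_le_int[OF _ r(2)] by simp
qed

lemma locator_eq_0: "i \<in> {1..K} - insert W S \<Longrightarrow> locator W S i = 0"
  unfolding locator_def by (rule prod_zero) auto

lemma cancel_mod:
  assumes "a * x mod int p = b * x mod int p" "\<not> int p dvd x" "a \<in> {0..<int p}" "b \<in> {0..<int p}"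
  shows "a = b"
proof -
  have "int p dvd (a - b) * x"
    using assms(1) by (simp add: mod_eq_dvd_iff left_diff_distrib)
  then have "int p dvd a - b"
    using assms(2) prime_dvd_mult_iff[OF prime_int_p] by blast
  then have "a mod int p = b mod int p"
    by (simp add: mod_eq_dvd_iff)
  then show ?thesis
    using assms(3,4) by simp
qed

lemma multiplier_unit: "v \<in> multipliers \<Longrightarrow> i \<in> {1..K} \<Longrightarrow> v i \<in> units"
  unfolding multipliers_def by (rule PiE_mem)

lemma finite_multipliers: "finite multipliers"
  unfolding multipliers_def by (intro finite_PiE) auto

text \<open>On \<open>S\<close> each entry is multiplied by a unit modulo \<open>p\<close>, and
  elsewhere it is kept, so the map is injective. Both sides have \<open>(p - 1) ^ K\<close>
  elements, which gives surjectivity.\<close>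

lemma bij_betw_split_multipliers:
  assumes S: "S \<in> supports" and W: "W \<in> {1..K} - S"
  shows "bij_betw (split_multipliers W S) multipliers (coeff_seqs \<times> (({1..K} - S) \<rightarrow>\<^sub>E units))"
proof -
  let ?T = "coeff_seqs \<times> (({1..K} - S) \<rightarrow>\<^sub>E units)"
  have sub: "S \<subseteq> {1..K}" and card: "card S = M" and fin: "finite S"
    using S finite_subset[of S "{1..K}"] by (auto simp: supports_def)
  have inj: "inj_on (split_multipliers W S) multipliers"
  proof (rule inj_onI)
    fix v v'
    assume v: "v \<in> multipliers" "v' \<in> multipliers"
      and eq: "split_multipliers W S v = split_multipliers W S v'"
    have "v i = v' i" if i: "i \<in> {1..K}" for i
    proof (cases "i \<in> S")
      case True
      have "v i * locator W S i mod int p = v' i * locator W S i mod int p"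
        using eq True fin by (auto simp: split_multipliers_def)
      moreover have "\<not> int p dvd locator W S i"
        using i True by (intro not_dvd_locator) simp_all
      moreover have "v i \<in> {0..<int p}" "v' i \<in> {0..<int p}"
        using multiplier_unit[OF v(1) i] multiplier_unit[OF v(2) i] by simp_all
      ultimately show ?thesis
        by (rule cancel_mod)
    next
      case False
      have "restrict v ({1..K} - S) = restrict v' ({1..K} - S)"
        using eq by (simp add: split_multipliers_def)
      from fun_cong[OF this, of i] show ?thesis
        using i False by simp
    qed
    then show "v = v'"
      using v unfolding multipliers_def by (intro PiE_ext[of v _ _ v'])
  qed
  have "split_multipliers W S v \<in> ?T" if v: "v \<in> multipliers" for v
  proof -
    have "v i * locator W S i mod int p \<in> units" if "i \<in> S" for i
      unfolding units_iff using that sub not_dvd_locator[of i W S] v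
        not_dvd_unit[OF multiplier_unit[OF v, of i]] prime_dvd_mult_iff[OF prime_int_p] by blast
    moreover have "restrict v ({1..K} - S) \<in> ({1..K} - S) \<rightarrow>\<^sub>E units"
      using multiplier_unit[OF v] by auto
    ultimately show ?thesis
      using fin card by (auto simp: split_multipliers_def coeff_seqs_eq)
  qed
  then have image: "split_multipliers W S ` multipliers \<subseteq> ?T"
    by blast
  have "card ?T = (p - 1) ^ M * (p - 1) ^ (K - M)"
    using card sub fin
    by (simp add: coeff_seqs_eq card_cartesian_product card_lists_length_eq card_funcsetE
        card_Diff_subset card_units del: card_atLeastLessThan_int)
  also have "\<dots> = card multipliers"
    using M_less by (simp add: multipliers_def card_funcsetE card_units flip: power_add del: card_atLeastLessThan_int)
  finally have "card ?T \<le> card (split_multipliers W S ` multipliers)"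
    using inj by (simp add: card_image)
  then have "split_multipliers W S ` multipliers = ?T"
    using image by (intro card_seteq) (auto simp: finite_coeff_seqs intro!: finite_PiE)
  with inj show ?thesis
    by (simp add: bij_betw_def)
qed

text \<open>The uniform \<open>C\<close> and the independent uniform multipliers outside
  \<open>S\<close> form a uniform pair, which the inverse bijection turns into a uniform multiplier
  vector. That the result is free of \<open>W\<close> and \<open>S\<close> is the source of
  privacy.\<close>

lemma bind_rs_query:
  assumes S: "S \<in> supports" and W: "W \<in> {1..K} - S"
  shows "pmf_of_set coeff_seqs \<bind> rs_query W S
    = map_pmf (to_nat_on multipliers) (pmf_of_set multipliers)"
proof -
  let ?U = "({1..K} - S) \<rightarrow>\<^sub>E units"
  let ?g = "inv_into multipliers (split_multipliers W S)"
  have U: "finite ?U" "?U \<noteq> {}"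
    using K_less M_less by (auto simp: PiE_eq_empty_iff intro!: finite_PiE)
  have "pmf_of_set coeff_seqs \<bind> rs_query W S
      = map_pmf (to_nat_on multipliers) (map_pmf ?g (pair_pmf (pmf_of_set coeff_seqs) (pmf_of_set ?U)))"
    unfolding rs_query_def pair_pmf_def map_pmf_def
    by (simp add: bind_assoc_pmf bind_return_pmf)
  also have "map_pmf ?g (pair_pmf (pmf_of_set coeff_seqs) (pmf_of_set ?U)) = pmf_of_set multipliers"
    unfolding pair_pmf_of_set[OF finite_coeff_seqs coeff_seqs_not_empty U]
    using finite_coeff_seqs coeff_seqs_not_empty U
    by (intro map_pmf_of_set_bij_betw bij_betw_inv_into bij_betw_split_multipliers[OF S W]) auto
  finally show ?thesis .
qed

section \<open>Privacy, recoverability, linearity and rate of the scheme\<close>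

lemma rs_private: WS_private
proof -
  define D where "D = pmf_of_set supports \<bind> (\<lambda>S. pmf_of_set ({1..K} - S) \<bind> (\<lambda>W. return_pmf (W, S)))"
  define E where "E = map_pmf (to_nat_on multipliers) (pmf_of_set multipliers)"
  have "map_pmf (\<lambda>\<omega>. ((rv_W \<omega>, rv_S \<omega>), rv_Q \<omega>)) joint
      = do {
          S \<leftarrow> pmf_of_set supports;
          W \<leftarrow> pmf_of_set ({1..K} - S);
          Q \<leftarrow> pmf_of_set coeff_seqs \<bind> rs_query W S;
          return_pmf ((W, S), Q)
        }"
    unfolding joint_def by (simp add: map_bind_pmf rv_W_def rv_S_def rv_Q_def bind_assoc_pmf)
  also have "\<dots> = do {
          S \<leftarrow> pmf_of_set supports;
          W \<leftarrow> pmf_of_set ({1..K} - S);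
          Q \<leftarrow> E;
          return_pmf ((W, S), Q)
        }"
    using supports_not_empty demands_not_empty M_less
    by (intro bind_pmf_cong refl) (simp_all add: finite_supports bind_rs_query E_def)
  also have "\<dots> = pair_pmf D E"
    by (simp add: D_def pair_pmf_def bind_assoc_pmf bind_return_pmf)
  finally have eq: "map_pmf (\<lambda>\<omega>. ((rv_W \<omega>, rv_S \<omega>), rv_Q \<omega>)) joint = pair_pmf D E" .
  \<comment> \<open>Projecting the product law identifies its factors as the marginals.\<close>
  have "map_pmf (\<lambda>\<omega>. (rv_W \<omega>, rv_S \<omega>)) joint = D"
    using arg_cong[OF eq, of "map_pmf fst"] by (simp add: map_pmf_comp map_fst_pair_pmf)
  moreover have "map_pmf rv_Q joint = E"
    using arg_cong[OF eq, of "map_pmf snd"] by (simp add: map_pmf_comp map_snd_pair_pmf)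
  ultimately show ?thesis
    unfolding WS_private_iff[OF M_less] eq by simp
qed

text \<open>Reindexing along the sorted support removes the list order, and the outer reduction
  absorbs the one inside \<open>split_multipliers\<close>. The side information is thus the part
  over \<open>S\<close> of the locator combination.\<close>

lemma rv_Y_mod:
  assumes S: "S \<in> supports" and C: "C = fst (split_multipliers W S v)"
  shows "rv_Y (W, S, C, X, Q) = (\<Sum>i\<in>S. v i * locator W S i * X i) mod int p"
proof -
  define xs where "xs = sorted_list_of_set S"
  have "finite S"
    using S finite_subset[of S "{1..K}"] by (auto simp: supports_def)
  then have xs: "set xs = S" "distinct xs" "length xs = M"
    using S by (auto simp: xs_def supports_def)
  have "rv_Y (W, S, C, X, Q) = (\<Sum>j<M. C ! j * X (xs ! j)) mod int p"
    by (simp add: rv_Y_def rv_C_def rv_X_def rv_S_def res_mult_eq sum_cong xs_def)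
  also have "(\<Sum>j<M. C ! j * X (xs ! j))
      = (\<Sum>j<M. (v (xs ! j) * locator W S (xs ! j) mod int p) * X (xs ! j))"
    using xs by (intro sum.cong) (simp_all add: C split_multipliers_def xs_def)
  also have "\<dots> = (\<Sum>i\<in>S. (v i * locator W S i mod int p) * X i)"
    using xs by (intro sum.reindex_bij_betw bij_betw_nth) auto
  also have "\<dots> mod int p = (\<Sum>i\<in>S. v i * locator W S i * X i) mod int p"
    by (intro sum_mod_cong) (simp add: mod_mult_left_eq)
  finally show ?thesis .
qed

text \<open>Weighting the answer symbols by the coefficients of the locator gives a combination of
  the messages in \<open>insert W S\<close>. Removing the side information leaves \<open>X W\<close>
  times a unit modulo \<open>p\<close>.\<close>

lemma rs_recoverable: recoverable
  unfolding recoverable_iff[OF M_less]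
proof (intro allI impI)
  fix W S C Q X X'
  assume joint: "(W, S, C, X, Q) \<in> set_pmf joint" "(W, S, C, X', Q) \<in> set_pmf joint"
    and ans: "rs_answer Q 0 X = rs_answer Q 0 X'"
    and Y: "rv_Y (W, S, C, X, Q) = rv_Y (W, S, C, X', Q)"
  have S: "S \<in> supports" and W: "W \<in> {1..K} - S" and C: "C \<in> coeff_seqs"
    and X: "X \<in> messages" "X' \<in> messages" and Q: "Q \<in> set_pmf (rs_query W S C)"
    using joint M_less by (auto simp: set_pmf_joint)
  have sub: "S \<subseteq> {1..K}" and card: "card S = M" and fin: "finite S"
    using S finite_subset[of S "{1..K}"] by (auto simp: supports_def)
  let ?U = "({1..K} - S) \<rightarrow>\<^sub>E units"
  have U: "finite ?U" "?U \<noteq> {}"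
    using K_less M_less by (auto simp: PiE_eq_empty_iff intro!: finite_PiE)
  obtain u where u: "u \<in> ?U"
    and Q_eq: "Q = to_nat_on multipliers (inv_into multipliers (split_multipliers W S) (C, u))"
    using Q U by (auto simp: rs_query_def)
  define v where "v = inv_into multipliers (split_multipliers W S) (C, u)"
  have img: "(C, u) \<in> split_multipliers W S ` multipliers"
    using bij_betw_split_multipliers[OF S W] C u by (simp add: bij_betw_def)
  have v: "v \<in> multipliers"
    unfolding v_def using img by (rule inv_into_into)
  have "split_multipliers W S v = (C, u)"
    unfolding v_def using img by (rule f_inv_into_f)
  then have C_eq: "C = fst (split_multipliers W S v)"
    by simp
  have dec: "from_nat_into multipliers Q = v"
    unfolding Q_eq v_def[symmetric] using v finite_multipliers
    by (simp add: countable_finite from_nat_into_to_nat_on)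
  \<comment> \<open>\<open>W\<close> and \<open>S\<close> take up M + 1 of the K points, leaving K -
    M - 1 roots. The exponents 0, ..., K - M - 1 are exactly those of the K - M answer
    symbols.\<close>
  have "card (int ` ({1..K} - insert W S)) = K - M - 1"
    using W sub card fin by (simp add: card_image card_Diff_subset)
  then obtain a where a: "(\<Prod>r\<in>int ` ({1..K} - insert W S). x - r) = (\<Sum>j\<le>K - M - 1. a j * x ^ j)" for x
    using prod_linear_eq_sum_powers[of "int ` ({1..K} - insert W S)"] by auto
  have loc: "locator W S i = (\<Sum>j<K - M. a j * int i ^ j)" for i
  proof -
    have "{..K - M - 1} = {..<K - M}"
      using M_less by auto
    then show ?thesis
      using a[of "int i"] by (simp add: locator_def prod.reindex)
  qed
  \<comment> \<open>Swapping the two sums exhibits the locator combination as a weighted sum of the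
    unreduced answer symbols.\<close>
  have total: "(\<Sum>i\<in>{1..K}. v i * locator W S i * Z i)
      = (\<Sum>j<K - M. a j * (\<Sum>i\<in>{1..K}. v i * int i ^ j * Z i))" for Z
    unfolding loc sum_distrib_left sum_distrib_right
    by (subst sum.swap) (simp add: mult_ac)
  have split: "(\<Sum>i\<in>{1..K}. v i * locator W S i * Z i)
      = v W * locator W S W * Z W + (\<Sum>i\<in>S. v i * locator W S i * Z i)" for Z
  proof -
    have "(\<Sum>i\<in>{1..K}. v i * locator W S i * Z i) = (\<Sum>i\<in>insert W S. v i * locator W S i * Z i)"
      using W sub by (intro sum.mono_neutral_right) (auto simp: locator_eq_0)
    then show ?thesis
      using W fin by simp
  qed
  have "(\<Sum>i\<in>{1..K}. v i * int i ^ j * X i) mod int p = (\<Sum>i\<in>{1..K}. v i * int i ^ j * X' i) mod int p"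
    if "j < K - M" for j
    using ans that by (simp add: rs_answer_def dec)
  then have "(a j * (\<Sum>i\<in>{1..K}. v i * int i ^ j * X i)) mod int p
      = (a j * (\<Sum>i\<in>{1..K}. v i * int i ^ j * X' i)) mod int p" if "j \<in> {..<K - M}" for j
    using that by (intro mod_mult_cong refl) simp
  then have "(\<Sum>i\<in>{1..K}. v i * locator W S i * X i) mod int p
      = (\<Sum>i\<in>{1..K}. v i * locator W S i * X' i) mod int p"
    unfolding total by (rule sum_mod_cong)
  moreover have "(\<Sum>i\<in>S. v i * locator W S i * X i) mod int p
      = (\<Sum>i\<in>S. v i * locator W S i * X' i) mod int p"
    using Y by (simp add: rv_Y_mod[OF S C_eq])
  \<comment> \<open>Both the full combination and its part over \<open>S\<close> are known modulo
    \<open>p\<close>; their difference is the term at \<open>W\<close>.\<close>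
  ultimately have "((\<Sum>i\<in>{1..K}. v i * locator W S i * X i) - (\<Sum>i\<in>S. v i * locator W S i * X i)) mod int p
      = ((\<Sum>i\<in>{1..K}. v i * locator W S i * X' i) - (\<Sum>i\<in>S. v i * locator W S i * X' i)) mod int p"
    by (rule mod_diff_cong)
  then have "v W * locator W S W * X W mod int p = v W * locator W S W * X' W mod int p"
    unfolding split add_diff_cancel_right' .
  then have "X W * (v W * locator W S W) mod int p = X' W * (v W * locator W S W) mod int p"
    by (simp only: mult.commute[of "v W * locator W S W"])
  moreover have "\<not> int p dvd v W * locator W S W"
    using not_dvd_unit[OF multiplier_unit[OF v]] not_dvd_locator[of W W S] W
      prime_dvd_mult_iff[OF prime_int_p] by blast
  moreover have "X W \<in> {0..<int p}" "X' W \<in> {0..<int p}"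
    using X W by (auto simp: messages_def carrier_eq PiE_iff)
  ultimately show "X W = X' W"
    by (rule cancel_mod)
qed

lemma rs_scalar_linear: scalar_linear
  unfolding scalar_linear_def
\<comment> \<open>The coefficients are reduced modulo \<open>p\<close> so that they lie in the
  field; the reduction of the whole sum absorbs the change.\<close>
proof (intro exI[of _ "\<lambda>Q. map (\<lambda>j i. from_nat_into multipliers Q i * int i ^ j mod int p) [0..<K - M]"]
    conjI allI ballI)
  show "\<omega> \<in> set_pmf joint \<Longrightarrow> rv_A \<omega> = map (\<lambda>v. \<Oplus>\<^bsub>residue_ring (int p)\<^esub>i\<in>{1..K}.
      v i \<otimes>\<^bsub>residue_ring (int p)\<^esub> rv_X \<omega> i)
      (map (\<lambda>j i. from_nat_into multipliers (rv_Q \<omega>) i * int i ^ j mod int p) [0..<K - M])" for \<omega>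
    by (simp add: rv_A_def rs_answer_def res_mult_eq sum_cong)
      (auto intro!: sum_mod_cong simp: mod_mult_left_eq)
qed (use K_less in auto)

lemma rs_rate: "rate = inverse (real K - real M)"
proof -
  have "rate = 1 / (real K - real M)"
  proof (rule rate_eq[OF M_less rs_private rs_recoverable])
    show "rv_A ` set_pmf joint \<subseteq> {xs. set xs \<subseteq> {0..<int p} \<and> length xs = K - M}"
      using K_less by (auto simp: rv_A_def rs_answer_def)
  qed (auto simp: card_lists_length_eq finite_lists_length_eq)
  then show ?thesis
    by (simp add: inverse_eq_divide)
qed

lemma rs_protocol:
  "scalar_linear_pir_pcsi_I (residue_ring (int p)) {0..<int p} p 1 K M rs_query rs_answer"
  by unfold_locales (rule rs_recoverable rs_private rs_scalar_linear)+

end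

section \<open>Matching the two bounds\<close>

theorem theorem1:
  fixes K M :: nat
  assumes "1 \<le> M" and "M \<le> K - 1"
  shows "capacity K M = ereal (inverse (real K - real M)) \<and>
         scalar_linear_capacity K M = ereal (inverse (real K - real M))"
proof -
  let ?r = "ereal (inverse (real K - real M))"
  have "M < K"
    using assms by simp
  \<comment> \<open>The supremum ranges over all field sizes, so a prime above \<open>K\<close> may
    be chosen.\<close>
  obtain p where p: "prime p" "K < p"
    using bigger_prime by blast
  interpret reed_solomon_scheme p K M
    using p \<open>M < K\<close> by unfold_locales
  have upper: "capacity K M \<le> ?r"
    unfolding capacity_def
  proof (rule Sup_least, clarify)
    fix F Fq q l query answer
    assume "pir_pcsi_I F Fq q l K M query answer"
    then interpret P: pir_pcsi_I F Fq q l K M query answer .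
    show "ereal P.rate \<le> ?r"
      using P.rate_le[OF \<open>M < K\<close> P.privacy P.recoverability] by (simp add: inverse_eq_divide)
  qed
  have lower: "?r \<le> scalar_linear_capacity K M"
    unfolding scalar_linear_capacity_def using rs_protocol rs_rate
    by (intro Sup_upper) (metis (mono_tags, lifting) mem_Collect_eq)
  \<comment> \<open>Every scalar-linear protocol is a protocol, so the two capacities lie between
    the lower and the upper bound, which coincide.\<close>
  have "scalar_linear_capacity K M \<le> capacity K M"
    unfolding scalar_linear_capacity_def capacity_def
    by (rule Sup_subset_mono) (use scalar_linear_pir_pcsi_I.axioms(1) in blast)
  with upper lower show ?thesis
    by (auto intro: antisym order_trans)
qed

end
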